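(* Let $p>1$ and let $b:\overline\Omega\to[0,\infty)$ belong to $C^\alpha(\overline\Omega)$ for some $0<\alpha<1$. Suppose $p\ge3$ or $b(x)\equiv b>0$ is constant. Then, for each $\lambda>\lambda_1$ and $\kappa>0$, the unique positive solution $(\lambda,\Theta_{\lambda,\kappa})$ of $$-\Delta v=\lambda f_\kappa(v)f_\kappa'(v)-b(x)(f_\kappa(v))^pf_\kappa'(v)\ \text{ in }\Omega,\qquad v=0\ \text{ on }\partial\Omega,$$ is linearly asymptotically stable, that is, $\lambda_1[\mathcal{L}(\lambda,\Theta_{\lambda,\kappa})]>0$.
   Context: $\Omega\subset\mathbb{R}^N$ ($N\ge1$) is a smooth bounded domain. For $\kappa\ge 0$, $f_\kappa:\mathbb{R}\to\mathbb{R}$ is the solution of the Cauchy problem $f_\kappa'(t)=\dfrac{1}{(1+2\kappa f_\kappa^2(t))^{1/2}}$, $f_\kappa(0)=0$. $\lambda_1$ is the principal eigenvalue of $-\Delta$ in $\Omega$ under homogeneous Dirichlet boundary conditions, and for a bounded potential $V$, $\lambda_1[-\Delta+V]$ is the principal eigenvalue of $-\Delta+V$ in $\Omega$ under homogeneous Dirichlet boundary conditions. Positive solutions are classical and strictly positive in $\Omega$; under the stated hypotheses a unique positive solution $\Theta_{\lambda,\kappa}$ exists for each $\lambda>\lambda_1$. The linearized operator at $(\lambda_0,u_0)$ is $$\mathcal{L}(\lambda_0,u_0):=-\Delta-\lambda_0[f_\kappa f_\kappa']'(u_0)+b(x)[f_\kappa^pf_\kappa']'(u_0),$$ subject to homogeneous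 Dirichlet boundary conditions on $\partial\Omega$, where $'=d/dt$. *)

theory Defs
  imports "HOL-Analysis.Analysis"
begin

subsection \<open>Functions of class \<open>C\<^sup>k\<close>, Laplacian, Hoelder continuity\<close>

definition partial_deriv :: "'a::euclidean_space \<Rightarrow> ('a \<Rightarrow> real) \<Rightarrow> 'a \<Rightarrow> real" where
  "partial_deriv i u x = frechet_derivative u (at x) i"

text \<open>Intended for open sets \<open>U\<close> only.\<close>

primrec Ck_on :: "nat \<Rightarrow> ('a::euclidean_space \<Rightarrow> real) \<Rightarrow> 'a set \<Rightarrow> bool" where
  "Ck_on 0 u U \<longleftrightarrow> continuous_on U u"
| "Ck_on (Suc k) u U \<longleftrightarrow>
     (\<forall>x\<in>U. u differentiable at x) \<and> (\<forall>i\<in>Basis. Ck_on k (partial_deriv i u) U)"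

definition laplacian :: "('a::euclidean_space \<Rightarrow> real) \<Rightarrow> 'a \<Rightarrow> real" where
  "laplacian u x = (\<Sum>i\<in>Basis. partial_deriv i (partial_deriv i u) x)"

definition hoelder_on :: "real \<Rightarrow> 'a::metric_space set \<Rightarrow> ('a \<Rightarrow> real) \<Rightarrow> bool" where
  "hoelder_on \<alpha> S u \<longleftrightarrow> (\<exists>C. \<forall>x\<in>S. \<forall>y\<in>S. \<bar>u x - u y\<bar> \<le> C * dist x y powr \<alpha>)"


subsection \<open>Smooth bounded domains\<close>

text \<open>The boundary is smooth if near each of its points \<open>\<Omega>\<close> is the sublevel set of a
  \<open>C\<^sup>\<infinity>\<close> function with nonvanishing gradient there; in particular \<open>\<Omega>\<close> lies locally on one
  side of its boundary.\<close>

definition smooth_bounded_domain :: "'a::euclidean_space set \<Rightarrow> bool" where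
  "smooth_bounded_domain \<Omega> \<longleftrightarrow>
     open \<Omega> \<and> connected \<Omega> \<and> \<Omega> \<noteq> {} \<and> bounded \<Omega> \<and>
     (\<forall>x\<in>frontier \<Omega>. \<exists>U g. open U \<and> x \<in> U \<and> (\<forall>k. Ck_on k g U) \<and>
        (\<exists>i\<in>Basis. partial_deriv i g x \<noteq> 0) \<and> \<Omega> \<inter> U = {y\<in>U. g y < 0})"


subsection \<open>Positive classical solutions and principal eigenvalues\<close>

text \<open>Functions are total; only their values on \<open>closure \<Omega>\<close> matter.\<close>

definition positive_dirichlet :: "'a::euclidean_space set \<Rightarrow> ('a \<Rightarrow> real) \<Rightarrow> bool" where
  "positive_dirichlet \<Omega> u \<longleftrightarrow>
     Ck_on 2 u \<Omega> \<and> continuous_on (closure \<Omega>) u \<and> (\<forall>x\<in>\<Omega>. 0 < u x) \<and> (\<forall>x\<in>frontier \<Omega>. u x = 0)"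

text \<open>The principal eigenvalue of an operator \<open>L\<close> under homogeneous Dirichlet conditions is the
  eigenvalue that has a positive eigenfunction. For \<open>L = -\<Delta> + V\<close> with \<open>V\<close> Hoelder continuous on
  the closure of a smooth bounded domain it exists, is unique, and its eigenfunctions are
  classical. It is stated as a relation between \<open>L\<close> and its principal eigenvalue.\<close>

definition is_principal_eigenvalue ::
    "'a::euclidean_space set \<Rightarrow> (('a \<Rightarrow> real) \<Rightarrow> 'a \<Rightarrow> real) \<Rightarrow> real \<Rightarrow> bool" where
  "is_principal_eigenvalue \<Omega> L \<mu> \<longleftrightarrow>
     (\<exists>\<phi>. positive_dirichlet \<Omega> \<phi> \<and> (\<forall>x\<in>\<Omega>. L \<phi> x = \<mu> * \<phi> x))"


subsection \<open>The change of variable \<open>f\<^sub>\<kappa>\<close>\<close>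

definition solves_cauchy :: "real \<Rightarrow> (real \<Rightarrow> real) \<Rightarrow> bool" where
  "solves_cauchy \<kappa> f \<longleftrightarrow>
     f 0 = 0 \<and> (\<forall>t. (f has_real_derivative 1 / sqrt (1 + 2 * \<kappa> * (f t)\<^sup>2)) (at t))"

definition fk :: "real \<Rightarrow> real \<Rightarrow> real" where
  "fk \<kappa> = (THE f. solves_cauchy \<kappa> f)"

lemma ex1_solves_cauchy:
  assumes "0 \<le> \<kappa>"
  shows "\<exists>!f. solves_cauchy \<kappa> f"
proof -
  define w where "w = (\<lambda>s::real. sqrt (1 + 2 * \<kappa> * s\<^sup>2))"
  have w1: "1 \<le> w s" for s using assms by (simp add: w_def)
  obtain F where F0: "F 0 = 0" and F': "\<And>s. (F has_real_derivative w s) (at s)"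
  proof (cases "\<kappa> = 0")
    case True
    show ?thesis
      by (rule that[of "\<lambda>s. s"]) (auto simp: w_def True)
  next
    case False
    define r where "r = sqrt (2 * \<kappa>)"
    have r: "r > 0" "2 * \<kappa> = r\<^sup>2" using False assms by (auto simp: r_def)
    define G where "G = (\<lambda>s. (s * sqrt (1 + (r * s)\<^sup>2) + arsinh (r * s) / r) / 2)"
    have "(G has_real_derivative w s) (at s)" for s
    proof -
      define q where "q = sqrt (1 + (r * s)\<^sup>2)"
      have pos: "1 + (r * s)\<^sup>2 > 0" by (simp add: add_pos_nonneg)
      have q: "q > 0" "q * q = 1 + (r * s)\<^sup>2" using pos by (auto simp: q_def)
      have qq: "sqrt ((r * s)\<^sup>2 + 1) = q" by (simp add: q_def add.commute)
      have d0: "((\<lambda>s. 1 + (r * s)\<^sup>2) has_real_derivative 2 * (r * s) * r) (at s)"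
        by (auto intro!: derivative_eq_intros)
      have d1: "((\<lambda>s. sqrt (1 + (r * s)\<^sup>2)) has_real_derivative
          (inverse q / 2) * (2 * (r * s) * r)) (at s)"
        unfolding q_def by (rule DERIV_chain2[OF DERIV_real_sqrt[OF pos] d0])
      have d2: "((\<lambda>s. arsinh (r * s)) has_real_derivative (1 / q) * r) (at s)"
        unfolding qq[symmetric]
        by (rule DERIV_chain2[OF arsinh_real_has_field_derivative]) (auto intro!: derivative_eq_intros)
      have "(G has_real_derivative
          (1 * q + (inverse q / 2) * (2 * (r * s) * r) * s + (1 / q) * r / r) / 2) (at s)"
        unfolding G_def q_def
        by (intro DERIV_cdivide DERIV_add DERIV_mult DERIV_ident d1[unfolded q_def] d2[unfolded q_def])
      moreover have "(1 * q + (inverse q / 2) * (2 * (r * s) * r) * s + (1 / q) * r / r) / 2 = q"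
        using q r by (simp add: field_simps power2_eq_square)
      moreover have "w s = q" by (simp add: w_def q_def r power_mult_distrib)
      ultimately show ?thesis by (simp only:)
    qed
    moreover have "G 0 = 0" by (simp add: G_def)
    ultimately show ?thesis using that by blast
  qed
  have cont: "continuous_on A F" for A
    using F' DERIV_isCont continuous_at_imp_continuous_on by blast
  have expand: "t - s \<le> F t - F s" if "s \<le> t" for s t
  proof -
    have "F s - s \<le> F t - t"
    proof (rule DERIV_nonneg_imp_nondecreasing[OF that])
      fix x
      show "\<exists>y. ((\<lambda>x. F x - x) has_real_derivative y) (at x) \<and> 0 \<le> y"
        by (rule exI[of _ "w x - 1"]) (use w1 in \<open>auto intro!: derivative_eq_intros F'\<close>)
    qed
    then show ?thesis by simp
  qed
  have expand_abs: "\<bar>t - s\<bar> \<le> \<bar>F t - F s\<bar>" for s t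
    using expand[of s t] expand[of t s] by linarith
  have inj: "s = t" if "F s = F t" for s t
    using expand_abs[of s t] that by simp
  have surj: "\<exists>s. F s = t" for t
  proof -
    have "F (- \<bar>t\<bar>) \<le> t" "t \<le> F \<bar>t\<bar>"
      using expand[of 0 "\<bar>t\<bar>"] expand[of "- \<bar>t\<bar>" 0] F0 by auto
    then show ?thesis
      using IVT'[of F "- \<bar>t\<bar>" t "\<bar>t\<bar>"] cont by auto
  qed
  define f where "f = inv F"
  have Ff: "F (f t) = t" for t
    unfolding f_def using surj by (metis surj_def surj_f_inv_f)
  have cf: "isCont f t" for t
  proof -
    have "\<bar>f s - f t\<bar> \<le> \<bar>s - t\<bar>" for s
      using expand_abs[of "f s" "f t"] by (simp add: Ff)
    then show ?thesis
      unfolding continuous_at_eps_delta dist_real_def by (meson le_less_trans)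
  qed
  have "(f has_real_derivative inverse (w (f t))) (at t)" for t
    by (rule DERIV_inverse_function[of F _ _ _ "t - 1" "t + 1"])
      (use F' cf Ff w1[of "f t"] in auto)
  moreover have "f 0 = 0" using Ff[of 0] F0 inj by metis
  ultimately have "solves_cauchy \<kappa> f"
    by (simp add: solves_cauchy_def w_def inverse_eq_divide)
  moreover have "h = f" if h: "solves_cauchy \<kappa> h" for h
  proof
    fix t
    have h': "(h has_real_derivative inverse (w (h t))) (at t)" for t
      using h by (simp add: solves_cauchy_def w_def inverse_eq_divide)
    have "((\<lambda>t. F (h t) - t) has_real_derivative 0) (at t)" for t
      using w1[of "h t"]
      by (auto intro!: derivative_eq_intros DERIV_chain2[OF F' h'])
    then have "F (h t) - t = F (h 0) - 0"
      using DERIV_isconst_all[of "\<lambda>t. F (h t) - t" t 0] by blast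
    then have "F (h t) = F (f t)" using h F0 Ff by (simp add: solves_cauchy_def)
    then show "h t = f t" by (rule inj)
  qed
  ultimately show ?thesis by blast
qed

lemma fk_solves_cauchy: "0 \<le> \<kappa> \<Longrightarrow> solves_cauchy \<kappa> (fk \<kappa>)"
  unfolding fk_def by (rule theI'[OF ex1_solves_cauchy])


subsection \<open>The boundary value problem and its linearization\<close>

text \<open>On positive solutions \<open>fk \<kappa> (v x) > 0\<close> in \<open>\<Omega>\<close>, so \<open>powr\<close> is the usual real power.\<close>

definition positive_solution ::
    "'a::euclidean_space set \<Rightarrow> real \<Rightarrow> real \<Rightarrow> ('a \<Rightarrow> real) \<Rightarrow> real \<Rightarrow> ('a \<Rightarrow> real) \<Rightarrow> bool" where
  "positive_solution \<Omega> \<kappa> p b lam v \<longleftrightarrow> positive_dirichlet \<Omega> v \<and>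
     (\<forall>x\<in>\<Omega>. - laplacian v x =
        lam * (fk \<kappa> (v x) * deriv (fk \<kappa>) (v x)) - b x * (fk \<kappa> (v x) powr p * deriv (fk \<kappa>) (v x)))"

definition linearized_op ::
    "real \<Rightarrow> real \<Rightarrow> ('a::euclidean_space \<Rightarrow> real) \<Rightarrow> real \<Rightarrow> ('a \<Rightarrow> real) \<Rightarrow> ('a \<Rightarrow> real) \<Rightarrow> 'a \<Rightarrow> real"
  where
  "linearized_op \<kappa> p b lam u \<phi> x =
     - laplacian \<phi> x
     - lam * deriv (\<lambda>t. fk \<kappa> t * deriv (fk \<kappa>) t) (u x) * \<phi> x
     + b x * deriv (\<lambda>t. fk \<kappa> t powr p * deriv (fk \<kappa>) t) (u x) * \<phi> x"

end

theory Submission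
  imports Defs
begin

text \<open>The function \<open>\<psi> = f\<^sub>\<kappa>(\<Theta>)\<close> is a strict supersolution of the linearized operator \<open>L\<close>: by
  concavity of \<open>f\<^sub>\<kappa>\<close>, \<open>L \<psi>\<close> is at least a positive multiple of
  \<open>\<lambda> (q\<^sup>2 - 1) + b \<psi>\<^sup>p\<^sup>-\<^sup>1 ((p - 2) q\<^sup>2 + 1)\<close> with \<open>q = 1 / f\<^sub>\<kappa>'(\<Theta>)\<close>. This is
  positive for \<open>p \<ge> 2\<close>, and for constant \<open>b\<close> because then \<open>b \<psi>\<^sup>p\<^sup>-\<^sup>1 \<le> \<lambda>\<close> by the maximum
  principle. If the eigenfunction \<open>\<phi>\<close> had an eigenvalue \<open>\<mu> \<le> 0\<close>, one could touch it from above by a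
  multiple of \<open>\<psi>\<close> at an interior point, which contradicts the strict inequality. That no touching
  escapes to the boundary follows from local barriers built from the functions defining the
  boundary, so neither Hopf's lemma nor boundary regularity of \<open>\<phi>\<close> and \<open>\<Theta>\<close> is used.\<close>

subsection \<open>Pointwise second derivatives\<close>

text \<open>The filter \<open>nhds 0\<close> contains the point 0 itself, so \<open>d\<close> and
  \<open>H\<close> are the first and second derivatives of \<open>w\<close> at 0. The second
  derivative is asked for at this one point, which is what the second derivative test at a maximum
  requires.\<close>

definition has_deriv2 :: "(real \<Rightarrow> real) \<Rightarrow> real \<Rightarrow> real \<Rightarrow> bool" where
  "has_deriv2 w d H \<longleftrightarrow> (\<exists>w'. (\<forall>\<^sub>F s in nhds 0. (w has_real_derivative w' s) (at s)) \<and>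
     w' 0 = d \<and> (w' has_real_derivative H) (at 0))"

text \<open>Here \<open>d i\<close> are the first partial derivatives; only derivatives along coordinate lines enter.\<close>

definition has_laplacian ::
    "('a::euclidean_space \<Rightarrow> real) \<Rightarrow> 'a \<Rightarrow> ('a \<Rightarrow> real) \<Rightarrow> real \<Rightarrow> bool" where
  "has_laplacian u x d l \<longleftrightarrow> (\<exists>H. (\<forall>i\<in>Basis. has_deriv2 (\<lambda>s. u (x + s *\<^sub>R i)) (d i) (H i)) \<and>
     l = (\<Sum>i\<in>Basis. H i))"

lemma has_deriv2_add:
  assumes "has_deriv2 v c G" "has_deriv2 w d H"
  shows "has_deriv2 (\<lambda>s. v s + w s) (c + d) (G + H)"
proof -
  obtain v' w' where
    v: "\<forall>\<^sub>F s in nhds 0. (v has_real_derivative v' s) (at s)" "v' 0 = c" "(v' has_real_derivative G) (at 0)" and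
    w: "\<forall>\<^sub>F s in nhds 0. (w has_real_derivative w' s) (at s)" "w' 0 = d" "(w' has_real_derivative H) (at 0)"
    using assms unfolding has_deriv2_def by blast
  have "\<forall>\<^sub>F s in nhds 0. ((\<lambda>s. v s + w s) has_real_derivative v' s + w' s) (at s)"
    using v(1) w(1) by eventually_elim (rule DERIV_add)
  with v w show ?thesis
    unfolding has_deriv2_def by (intro exI[of _ "\<lambda>s. v' s + w' s"] conjI DERIV_add) simp_all
qed

lemma has_deriv2_compose:
  assumes w: "has_deriv2 w d H"
    and h: "\<And>t. (h has_real_derivative h' t) (at t)"
    and h2: "(h' has_real_derivative h2) (at (w 0))"
  shows "has_deriv2 (\<lambda>s. h (w s)) (h' (w 0) * d) (h' (w 0) * H + h2 * d\<^sup>2)"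
proof -
  obtain w' where
    w: "\<forall>\<^sub>F s in nhds 0. (w has_real_derivative w' s) (at s)" "w' 0 = d" "(w' has_real_derivative H) (at 0)"
    using w unfolding has_deriv2_def by blast
  have w0: "(w has_real_derivative d) (at 0)"
    using eventually_nhds_x_imp_x[OF w(1)] unfolding w(2) .
  have "\<forall>\<^sub>F s in nhds 0. ((\<lambda>s. h (w s)) has_real_derivative h' (w s) * w' s) (at s)"
    using w(1) by eventually_elim (rule DERIV_chain2[OF h])
  moreover have "((\<lambda>s. h' (w s) * w' s) has_real_derivative
      (h2 * d) * w' 0 + H * h' (w 0)) (at 0)"
    by (rule DERIV_mult[OF DERIV_chain2[OF h2 w0] w(3)])
  ultimately show ?thesis
    unfolding has_deriv2_def using w(2)
    by (intro exI[of _ "\<lambda>s. h' (w s) * w' s"]) (auto simp: power2_eq_square algebra_simps)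
qed

text \<open>If \<open>H > 0\<close>, the derivative, which vanishes at the maximum, is positive just
  to the right of 0, so \<open>w\<close> would increase there.\<close>

lemma has_deriv2_local_max:
  assumes w: "has_deriv2 w d H" and max: "\<forall>\<^sub>F s in nhds 0. w s \<le> w 0"
  shows "H \<le> 0"
proof (rule ccontr)
  assume "\<not> H \<le> 0"
  then have H: "H > 0" by simp
  obtain w' where
    w: "\<forall>\<^sub>F s in nhds 0. (w has_real_derivative w' s) (at s)" "(w' has_real_derivative H) (at 0)"
    using w unfolding has_deriv2_def by blast
  obtain r where r: "r > 0" "\<And>s. \<bar>s\<bar> < r \<Longrightarrow> (w has_real_derivative w' s) (at s) \<and> w s \<le> w 0"
    using eventually_conj[OF w(1) max] unfolding eventually_nhds_metric dist_real_def by auto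
  have "w' 0 = 0"
    using DERIV_local_max[of w "w' 0" 0 r] r by auto
  moreover obtain e where e: "e > 0" "\<And>h. 0 < h \<Longrightarrow> h < e \<Longrightarrow> w' 0 < w' (0 + h)"
    using DERIV_pos_inc_right[OF w(2) H] by blast
  ultimately have pos: "w' s > 0" if "0 < s" "s < e" for s
    using that by force
  define s where "s = min e r / 2"
  have s: "0 < s" "s < e" "s < r" using e(1) r(1) by (auto simp: s_def min_def)
  have "w 0 < w s"
  proof (rule DERIV_pos_imp_increasing_open[OF s(1)])
    fix x assume "0 < x" "x < s"
    then show "\<exists>y. (w has_real_derivative y) (at x) \<and> 0 < y"
      using r(2)[of x] pos[of x] s by auto
  next
    show "continuous_on {0..s} w"
      by (rule DERIV_continuous_on[where D = w'], rule has_field_derivative_at_within)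
        (use r(2) s in auto)
  qed
  then show False using r(2)[of s] s by auto
qed

lemma has_laplacian_add:
  "has_laplacian u x c k \<Longrightarrow> has_laplacian v x d l \<Longrightarrow>
     has_laplacian (\<lambda>x. u x + v x) x (\<lambda>i. c i + d i) (k + l)"
  unfolding has_laplacian_def
  by (clarify, rule_tac x = "\<lambda>i. H i + Ha i" in exI) (auto intro: has_deriv2_add simp: sum.distrib)

text \<open>The second-order chain rule on each coordinate line, summed. The factor
  \<open>h2\<close> of the squared gradient is where the concavity of \<open>fk \<kappa>\<close>
  enters later.\<close>

lemma has_laplacian_compose:
  assumes "has_laplacian u x d l"
    and "\<And>t. (h has_real_derivative h' t) (at t)"
    and "(h' has_real_derivative h2) (at (u x))"
  shows "has_laplacian (\<lambda>x. h (u x)) x (\<lambda>i. h' (u x) * d i)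
           (h' (u x) * l + h2 * (\<Sum>i\<in>Basis. (d i)\<^sup>2))"
proof -
  obtain H where H: "\<And>i. i \<in> Basis \<Longrightarrow> has_deriv2 (\<lambda>s. u (x + s *\<^sub>R i)) (d i) (H i)"
    and l: "l = (\<Sum>i\<in>Basis. H i)"
    using assms(1) unfolding has_laplacian_def by blast
  have "has_deriv2 (\<lambda>s. h (u (x + s *\<^sub>R i))) (h' (u x) * d i) (h' (u x) * H i + h2 * (d i)\<^sup>2)"
    if "i \<in> Basis" for i
    using has_deriv2_compose[OF H[OF that] assms(2), where ?h2.0=h2] assms(3) by simp
  then show ?thesis
    unfolding has_laplacian_def l
    by (intro exI[of _ "\<lambda>i. h' (u x) * H i + h2 * (d i)\<^sup>2"])
      (auto simp: sum.distrib sum_distrib_left)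
qed

lemma has_laplacian_cmult:
  assumes "has_laplacian u x d l"
  shows "has_laplacian (\<lambda>x. c * u x) x (\<lambda>i. c * d i) (c * l)"
  using has_laplacian_compose[OF assms, of "\<lambda>t. c * t" "\<lambda>t. c" 0]
  by (auto intro!: derivative_eq_intros)

lemma has_laplacian_norm_power2:
  fixes x y :: "'a::euclidean_space"
  shows "has_laplacian (\<lambda>x. (norm (x - y))\<^sup>2) x (\<lambda>i. 2 * ((x - y) \<bullet> i)) (2 * DIM('a))"
proof -
  have "has_deriv2 (\<lambda>s. (norm (x + s *\<^sub>R i - y))\<^sup>2) (2 * ((x - y) \<bullet> i)) 2" if "i \<in> Basis" for i
  proof -
    have "(norm (x + s *\<^sub>R i - y))\<^sup>2 = (norm (x - y))\<^sup>2 + 2 * ((x - y) \<bullet> i) * s + s\<^sup>2" for s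
      using that unfolding power2_norm_eq_inner
      by (simp add: inner_simps inner_commute algebra_simps power2_eq_square)
    then have "((\<lambda>s. (norm (x + s *\<^sub>R i - y))\<^sup>2) has_real_derivative 2 * ((x - y) \<bullet> i) + 2 * s) (at s)" for s
      by (auto intro!: derivative_eq_intros)
    moreover have "((\<lambda>s. 2 * ((x - y) \<bullet> i) + 2 * s) has_real_derivative 2) (at 0)"
      by (auto intro!: derivative_eq_intros)
    ultimately show ?thesis
      unfolding has_deriv2_def
      by (intro exI[of _ "\<lambda>s. 2 * ((x - y) \<bullet> i) + 2 * s"]) simp
  qed
  then show ?thesis
    unfolding has_laplacian_def by (intro exI[of _ "\<lambda>_. 2"]) auto
qed

text \<open>Restricted to each coordinate line through \<open>x\<close>, the function has a local
  maximum, so every summand \<open>H i\<close> is nonpositive.\<close>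

lemma has_laplacian_local_max:
  assumes u: "has_laplacian u x d l" and "open S" "x \<in> S" and max: "\<And>y. y \<in> S \<Longrightarrow> u y \<le> u x"
  shows "l \<le> 0"
proof -
  obtain H where H: "\<And>i. i \<in> Basis \<Longrightarrow> has_deriv2 (\<lambda>s. u (x + s *\<^sub>R i)) (d i) (H i)"
    and l: "l = (\<Sum>i\<in>Basis. H i)"
    using u unfolding has_laplacian_def by blast
  have "\<forall>\<^sub>F s in nhds 0. u (x + s *\<^sub>R i) \<le> u (x + 0 *\<^sub>R i)" for i
  proof -
    have "((\<lambda>s::real. x + s *\<^sub>R i) \<longlongrightarrow> x + 0 *\<^sub>R i) (nhds 0)"
      by (intro tendsto_intros filterlim_ident)
    then have "\<forall>\<^sub>F s::real in nhds 0. x + s *\<^sub>R i \<in> S"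
      using topological_tendstoD assms(2,3) by fastforce
    then show ?thesis by eventually_elim (use max in auto)
  qed
  then have "H i \<le> 0" if "i \<in> Basis" for i
    using has_deriv2_local_max[OF H[OF that]] by blast
  then show ?thesis unfolding l by (rule sum_nonpos)
qed

lemma has_real_derivative_line:
  fixes u :: "'a::euclidean_space \<Rightarrow> real"
  assumes "u differentiable at (x + s *\<^sub>R i)"
  shows "((\<lambda>s. u (x + s *\<^sub>R i)) has_real_derivative partial_deriv i u (x + s *\<^sub>R i)) (at s)"
proof -
  let ?D = "frechet_derivative u (at (x + s *\<^sub>R i))"
  have D: "(u has_derivative ?D) (at (x + s *\<^sub>R i))"
    using assms frechet_derivative_works by blast
  have "((\<lambda>s. x + s *\<^sub>R i) has_derivative (\<lambda>h. h *\<^sub>R i)) (at s)"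
    by (auto intro!: derivative_eq_intros)
  from has_derivative_compose[OF this D]
  have "((\<lambda>s. u (x + s *\<^sub>R i)) has_derivative (\<lambda>h. ?D (h *\<^sub>R i))) (at s)" .
  moreover have "?D (h *\<^sub>R i) = ?D i * h" for h
    using linear_frechet_derivative[OF assms] by (simp add: linear_cmul)
  ultimately show ?thesis
    by (simp add: has_field_derivative_def partial_deriv_def)
qed

text \<open>Brings eigenfunctions, solutions and boundary functions, all given through
  \<open>Ck_on\<close>, into the calculus of \<open>has_laplacian\<close>.\<close>

lemma has_laplacian_Ck_on:
  assumes u: "Ck_on 2 u U" and U: "open U" "x \<in> U"
  shows "has_laplacian u x (\<lambda>i. partial_deriv i u x) (laplacian u x)"
proof -
  have u1: "u differentiable at y" if "y \<in> U" for y
    using u that by (simp add: numeral_2_eq_2)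
  have u2: "partial_deriv i u differentiable at x" if "i \<in> Basis" for i
    using u that U by (simp add: numeral_2_eq_2)
  have "has_deriv2 (\<lambda>s. u (x + s *\<^sub>R i)) (partial_deriv i u x) (partial_deriv i (partial_deriv i u) x)"
    if "i \<in> Basis" for i
  proof -
    have "((\<lambda>s::real. x + s *\<^sub>R i) \<longlongrightarrow> x + 0 *\<^sub>R i) (nhds 0)"
      by (intro tendsto_intros filterlim_ident)
    then have "\<forall>\<^sub>F s::real in nhds 0. x + s *\<^sub>R i \<in> U"
      using topological_tendstoD U by fastforce
    then have "\<forall>\<^sub>F s in nhds 0.
        ((\<lambda>s. u (x + s *\<^sub>R i)) has_real_derivative partial_deriv i u (x + s *\<^sub>R i)) (at s)"
      by eventually_elim (use u1 has_real_derivative_line in blast)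
    moreover have "((\<lambda>s. partial_deriv i u (x + s *\<^sub>R i)) has_real_derivative
        partial_deriv i (partial_deriv i u) x) (at 0)"
      using has_real_derivative_line[of "partial_deriv i u" x 0 i] u2[OF that] by simp
    ultimately show ?thesis
      unfolding has_deriv2_def
      by (intro exI[of _ "\<lambda>s. partial_deriv i u (x + s *\<^sub>R i)"]) auto
  qed
  then show ?thesis
    unfolding has_laplacian_def laplacian_def
    by (intro exI[of _ "\<lambda>i. partial_deriv i (partial_deriv i u) x"]) simp
qed

subsection \<open>A comparison principle up to the boundary\<close>

text \<open>The barrier is a multiple of the squared distance to \<open>y\<close> plus
  \<open>A * (- g - B * g\<^sup>2)\<close>, where \<open>g\<close> defines the boundary near
  \<open>y\<close>. The first summand makes it reach 1 on the sphere. In the Laplacian of the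
  second, \<open>- 2 * B\<close> times the squared gradient of \<open>g\<close> dominates, since
  that gradient does not vanish near \<open>y\<close>; a large \<open>A\<close> then outweighs the
  first summand.\<close>

lemma boundary_barrier:
  fixes y :: "'a::euclidean_space"
  assumes dom: "smooth_bounded_domain \<Omega>" and y: "y \<in> frontier \<Omega>" and \<Lambda>: "0 \<le> \<Lambda>"
  obtains \<eta> \<rho> W where "0 < \<rho>" "open W" "y \<in> W" "W \<subseteq> ball y \<rho>"
    "continuous_on (cball y \<rho>) \<eta>"
    "\<And>x. x \<in> W \<Longrightarrow> \<eta> x < 1"
    "\<And>x. x \<in> cball y \<rho> \<inter> closure \<Omega> \<Longrightarrow> 0 \<le> \<eta> x"
    "\<And>x. x \<in> sphere y \<rho> \<inter> closure \<Omega> \<Longrightarrow> 1 \<le> \<eta> x"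
    "\<And>x. x \<in> ball y \<rho> \<inter> \<Omega> \<Longrightarrow> \<exists>d l. has_laplacian \<eta> x d l \<and> l < - \<Lambda>"
proof -
  obtain U g where U: "open U" "y \<in> U" and gk: "\<And>k. Ck_on k g U"
    and nz: "\<exists>i\<in>Basis. partial_deriv i g y \<noteq> 0" and sub: "\<Omega> \<inter> U = {y\<in>U. g y < 0}"
    and op: "open \<Omega>"
    using dom y unfolding smooth_bounded_domain_def by blast
  have g2: "Ck_on 2 g U" by (rule gk)
  have gdiff: "g differentiable at x" if "x \<in> U" for x
    using g2 that by (simp add: numeral_2_eq_2)
  have gc: "continuous_on U g"
    using gdiff differentiable_imp_continuous_within
    by (auto intro!: differentiable_imp_continuous_on differentiable_at_imp_differentiable_on)
  \<comment> \<open>The set where \<open>g\<close> is positive is open and misses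
    \<open>\<Omega>\<close>, hence it also misses the closure.\<close>
  have le0: "g x \<le> 0" if "x \<in> U" "x \<in> closure \<Omega>" for x
  proof (rule ccontr)
    assume "\<not> g x \<le> 0"
    then have "x \<in> U \<inter> g -` {0<..}" using that by auto
    moreover have "open (U \<inter> g -` {0<..})"
      using continuous_open_preimage[OF gc U(1)] by simp
    ultimately have "(U \<inter> g -` {0<..}) \<inter> \<Omega> \<noteq> {}"
      using that(2) by (meson closure_iff_nhds_not_empty order_refl open_Int_closure_eq_empty disjoint_iff)
    then show False using sub by force
  qed
  have gy: "g y = 0"
  proof -
    have "y \<notin> \<Omega>" "y \<in> closure \<Omega>" using y op by (auto simp: frontier_def interior_open)
    then show ?thesis using le0[of y] U sub by force
  qed
  define G where "G = (\<lambda>x. \<Sum>i\<in>Basis. (partial_deriv i g x)\<^sup>2)"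
  \<comment> \<open>Half of the value at \<open>y\<close>: a lower bound for the squared gradient
    \<open>G\<close> that persists near \<open>y\<close>. Likewise \<open>D\<close> below bounds the
    Laplacian of \<open>g\<close> near \<open>y\<close>.\<close>
  define m where "m = G y / 2"
  have m: "m > 0"
    using nz unfolding m_def G_def by (auto intro!: sum_pos2)
  define D where "D = \<bar>laplacian g y\<bar> + 1"
  have pc: "continuous_on U (partial_deriv i g)" if "i \<in> Basis" for i
  proof -
    have "\<forall>x\<in>U. partial_deriv i g differentiable at x"
      using g2 that by (simp add: numeral_2_eq_2)
    then show ?thesis
      by (auto intro!: differentiable_imp_continuous_on differentiable_at_imp_differentiable_on)
  qed
  have Gc: "continuous_on U G"
    unfolding G_def by (intro continuous_intros pc)
  have lc: "continuous_on U (laplacian g)"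
    unfolding laplacian_def using g2 by (intro continuous_intros) (auto simp: numeral_2_eq_2)
  \<comment> \<open>Chosen so that \<open>2 * B * m = 3 * D + 1\<close>: the gradient term then
    beats the other term, which is at most \<open>3 * D\<close>, by 1.\<close>
  define B where "B = (3 * D + 1) / (2 * m)"
  have D: "D \<ge> 1" by (simp add: D_def)
  have B: "B > 0" using m D by (simp add: B_def)
  define S where "S = (U \<inter> G -` {m<..}) \<inter> (U \<inter> laplacian g -` {-D<..<D}) \<inter> (U \<inter> g -` {-(1/B)<..<1/B})"
  have "open S"
    unfolding S_def
    by (rule open_Int[OF open_Int[OF continuous_open_preimage[OF Gc U(1)]
            continuous_open_preimage[OF lc U(1)]] continuous_open_preimage[OF gc U(1)]]) simp_all
  moreover have "y \<in> S"
    using U m B gy by (auto simp: S_def m_def D_def)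
  ultimately obtain \<rho> where \<rho>: "\<rho> > 0" "cball y \<rho> \<subseteq> S"
    using open_contains_cball by blast
  have inS: "x \<in> U" "m < G x" "\<bar>laplacian g x\<bar> \<le> D" "\<bar>B * g x\<bar> \<le> 1" if "x \<in> cball y \<rho>" for x
    using that \<rho> B by (auto simp: S_def abs_mult abs_le_iff field_simps dest!: subsetD)
  \<comment> \<open>\<open>C\<close> normalizes the quadratic term to 1 on the sphere.
    \<open>A\<close> pays for its Laplacian and for \<open>\<Lambda>\<close>, and the extra 1 makes
    the final inequality strict.\<close>
  define C where "C = 1 / \<rho>\<^sup>2"
  define A where "A = 2 * DIM('a) * C + \<Lambda> + 1"
  have C: "C > 0" using \<rho> by (simp add: C_def)
  have A: "A > 0" using C \<Lambda> by (simp add: A_def add_nonneg_pos)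
  define \<eta> where "\<eta> = (\<lambda>x. C * (norm (x - y))\<^sup>2 + A * (- g x - B * (g x)\<^sup>2))"
  have \<eta>c: "continuous_on (cball y \<rho>) \<eta>"
    unfolding \<eta>_def using inS(1) by (intro continuous_intros continuous_on_subset[OF gc]) auto
  \<comment> \<open>Both factors of \<open>(- g x) * (1 + B * g x)\<close> are nonnegative, by
    \<open>g x \<le> 0\<close> on the closure and by the bound on \<open>B * g x\<close> in the
    ball.\<close>
  have gpart: "0 \<le> A * (- g x - B * (g x)\<^sup>2)" if "x \<in> cball y \<rho> \<inter> closure \<Omega>" for x
  proof -
    have "- g x - B * (g x)\<^sup>2 = (- g x) * (1 + B * g x)"
      by (simp add: algebra_simps power2_eq_square)
    moreover have "(- g x) * (1 + B * g x) \<ge> 0"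
      using that inS[of x] le0[of x] by (intro mult_nonneg_nonneg) auto
    ultimately show ?thesis using A by (metis less_imp_le mult_nonneg_nonneg)
  qed
  define W where "W = ball y \<rho> \<inter> \<eta> -` {..<1}"
  show thesis
  proof (rule that[of \<rho> W \<eta>])
    show "0 < \<rho>" "continuous_on (cball y \<rho>) \<eta>" by fact+
    show "open W"
      unfolding W_def using \<eta>c
      by (intro continuous_open_preimage continuous_on_subset[OF \<eta>c]) auto
    show "y \<in> W" using \<rho> gy by (simp add: W_def \<eta>_def)
    show "W \<subseteq> ball y \<rho>" "\<And>x. x \<in> W \<Longrightarrow> \<eta> x < 1" by (auto simp: W_def)
    show "0 \<le> \<eta> x" if "x \<in> cball y \<rho> \<inter> closure \<Omega>" for x
      using gpart[OF that] C by (simp add: \<eta>_def)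
    show "1 \<le> \<eta> x" if "x \<in> sphere y \<rho> \<inter> closure \<Omega>" for x
    proof -
      have "C * (norm (x - y))\<^sup>2 = 1"
        using that \<rho> by (auto simp: C_def dist_norm norm_minus_commute)
      then show ?thesis using gpart[of x] that by (simp add: \<eta>_def)
    qed
    show "\<exists>d l. has_laplacian \<eta> x d l \<and> l < - \<Lambda>" if x: "x \<in> ball y \<rho> \<inter> \<Omega>" for x
    proof -
      have xU: "x \<in> cball y \<rho>" using x by auto
      note xS = inS[OF xU]
      have "has_laplacian (\<lambda>x. - g x - B * (g x)\<^sup>2) x
          (\<lambda>i. (- 1 - 2 * B * g x) * partial_deriv i g x)
          ((- 1 - 2 * B * g x) * laplacian g x + (- 2 * B) * G x)"
        unfolding G_def
        by (rule has_laplacian_compose[OF has_laplacian_Ck_on[OF g2 U(1) xS(1)],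
              where h = "\<lambda>t. - t - B * t\<^sup>2" and h' = "\<lambda>t. - 1 - 2 * B * t"])
          (auto intro!: derivative_eq_intros)
      from has_laplacian_add[OF has_laplacian_cmult[OF has_laplacian_norm_power2]
          has_laplacian_cmult[OF this], of C y A]
      have "\<exists>d. has_laplacian \<eta> x d (C * (2 * DIM('a)) +
          A * ((- 1 - 2 * B * g x) * laplacian g x + (- 2 * B) * G x))"
        unfolding \<eta>_def by blast
      moreover have "(- 1 - 2 * B * g x) * laplacian g x + (- 2 * B) * G x \<le> - 1"
      proof -
        have "(- 1 - 2 * B * g x) * laplacian g x \<le> \<bar>- 1 - 2 * B * g x\<bar> * \<bar>laplacian g x\<bar>"
          by (metis abs_ge_self abs_mult)
        also have "\<dots> \<le> 3 * D"
          by (rule mult_mono) (use xS D in auto)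
        finally have "(- 1 - 2 * B * g x) * laplacian g x \<le> 3 * D" .
        moreover have "B * G x \<ge> B * m" using xS B by simp
        moreover have "2 * (B * m) = 3 * D + 1" using m by (simp add: B_def)
        ultimately show ?thesis by linarith
      qed
      then have "A * ((- 1 - 2 * B * g x) * laplacian g x + (- 2 * B) * G x) \<le> A * (- 1)"
        using A by (intro mult_left_mono) auto
      then have "C * (2 * DIM('a)) + A * ((- 1 - 2 * B * g x) * laplacian g x + (- 2 * B) * G x) < - \<Lambda>"
        using A_def by (simp add: mult.commute)
      ultimately show ?thesis by blast
    qed
  qed
qed

text \<open>If \<open>z\<close> had a positive maximum \<open>M\<close> at a point of
  \<open>W\<close>, then \<open>z - M * \<eta>\<close> would be positive there. Its maximum over the
  closed ball within the closure is then positive too; it avoids the sphere, where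
  \<open>\<eta> \<ge> 1\<close>, and the frontier, where \<open>z \<le> 0\<close>. At such an
  interior point the two differential inequalities force a positive Laplacian. Note that
  \<open>W\<close> depends on \<open>y\<close> and \<open>\<Lambda>\<close> but not on
  \<open>z\<close>, so it can be fixed before the function to be compared is known.\<close>

lemma no_max_near_boundary:
  fixes y :: "'a::euclidean_space"
  assumes dom: "smooth_bounded_domain \<Omega>" and y: "y \<in> frontier \<Omega>" and \<Lambda>: "0 \<le> \<Lambda>"
  obtains W where "open W" "y \<in> W"
    "\<And>z x. \<lbrakk>continuous_on (closure \<Omega>) z; \<And>x. x \<in> frontier \<Omega> \<Longrightarrow> z x \<le> 0;
       \<And>x. x \<in> \<Omega> \<Longrightarrow> 0 < z x \<Longrightarrow> \<exists>d l. has_laplacian z x d l \<and> - l \<le> \<Lambda> * z x;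
       x \<in> W \<inter> closure \<Omega>; \<And>x'. x' \<in> closure \<Omega> \<Longrightarrow> z x' \<le> z x\<rbrakk> \<Longrightarrow> z x \<le> 0"
proof -
  obtain \<eta> \<rho> W where b: "0 < \<rho>" "open W" "y \<in> W" "W \<subseteq> ball y \<rho>"
    and \<eta>c: "continuous_on (cball y \<rho>) \<eta>"
    and \<eta>W: "\<And>x. x \<in> W \<Longrightarrow> \<eta> x < 1"
    and \<eta>0: "\<And>x. x \<in> cball y \<rho> \<inter> closure \<Omega> \<Longrightarrow> 0 \<le> \<eta> x"
    and \<eta>1: "\<And>x. x \<in> sphere y \<rho> \<inter> closure \<Omega> \<Longrightarrow> 1 \<le> \<eta> x"
    and \<eta>l: "\<And>x. x \<in> ball y \<rho> \<inter> \<Omega> \<Longrightarrow> \<exists>d l. has_laplacian \<eta> x d l \<and> l < - \<Lambda>"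
    by (rule boundary_barrier[OF dom y \<Lambda>]) (rule that; assumption)
  have op: "open \<Omega>" and bd: "bounded \<Omega>"
    using dom by (auto simp: smooth_bounded_domain_def)
  show thesis
  proof (rule that[OF b(2,3)], rule ccontr)
    fix z x
    assume zc: "continuous_on (closure \<Omega>) z" and zf: "\<And>x. x \<in> frontier \<Omega> \<Longrightarrow> z x \<le> 0"
      and zl: "\<And>x. x \<in> \<Omega> \<Longrightarrow> 0 < z x \<Longrightarrow> \<exists>d l. has_laplacian z x d l \<and> - l \<le> \<Lambda> * z x"
      and x: "x \<in> W \<inter> closure \<Omega>" and max: "\<And>x'. x' \<in> closure \<Omega> \<Longrightarrow> z x' \<le> z x"
      and "\<not> z x \<le> 0"
    define M where "M = z x"
    have M: "M > 0" using \<open>\<not> z x \<le> 0\<close> by (simp add: M_def)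
    define k where "k = (\<lambda>x. z x + (- M) * \<eta> x)"
    have xin: "x \<in> cball y \<rho> \<inter> closure \<Omega>" using x b(4) by auto
    have "continuous_on (cball y \<rho> \<inter> closure \<Omega>) k"
      unfolding k_def
      by (intro continuous_intros continuous_on_subset[OF zc] continuous_on_subset[OF \<eta>c]) auto
    moreover have "compact (cball y \<rho> \<inter> closure \<Omega>)"
      using bd by (intro compact_Int_closed) auto
    ultimately obtain x1 where x1: "x1 \<in> cball y \<rho> \<inter> closure \<Omega>"
      and mx: "\<And>x'. x' \<in> cball y \<rho> \<inter> closure \<Omega> \<Longrightarrow> k x' \<le> k x1"
      using continuous_attains_sup[of "cball y \<rho> \<inter> closure \<Omega>" k] xin by blast
    have "M * \<eta> x < M * 1" using \<eta>W[of x] x M by (intro mult_strict_left_mono) auto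
    then have "0 < k x" by (simp add: k_def M_def)
    then have "0 < k x1" using mx[OF xin] by simp
    then have gt: "M * \<eta> x1 < z x1" by (simp add: k_def)
    have "0 \<le> M * \<eta> x1" using \<eta>0[OF x1] M by simp
    then have zpos: "0 < z x1" using gt by simp
    have x1\<Omega>: "x1 \<in> \<Omega>"
      using zf[of x1] zpos x1 op by (auto simp: frontier_def interior_open)
    have "x1 \<in> ball y \<rho>"
    proof (rule ccontr)
      assume "x1 \<notin> ball y \<rho>"
      then have "1 \<le> \<eta> x1" using \<eta>1[of x1] x1 by auto
      then have "M * 1 \<le> M * \<eta> x1" using M by (intro mult_left_mono) auto
      then show False using gt max[of x1] x1 by (simp add: M_def)
    qed
    then obtain d l where l: "has_laplacian \<eta> x1 d l" "l < - \<Lambda>" using \<eta>l x1\<Omega> by blast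
    obtain c k' where k': "has_laplacian z x1 c k'" "- k' \<le> \<Lambda> * z x1" using zl[OF x1\<Omega> zpos] by blast
    have "k' + (- M) * l \<le> 0"
    proof (rule has_laplacian_local_max)
      show "has_laplacian k x1 (\<lambda>i. c i + (- M) * d i) (k' + (- M) * l)"
        unfolding k_def by (intro has_laplacian_add has_laplacian_cmult k' l)
      show "open (ball y \<rho> \<inter> \<Omega>)" "x1 \<in> ball y \<rho> \<inter> \<Omega>"
        using op \<open>x1 \<in> ball y \<rho>\<close> x1\<Omega> by auto
      show "k x' \<le> k x1" if "x' \<in> ball y \<rho> \<inter> \<Omega>" for x'
        using mx[of x'] that closure_subset by auto
    qed
    moreover have "\<Lambda> * z x1 \<le> \<Lambda> * M" using \<Lambda> max[of x1] x1 by (auto intro: mult_left_mono simp: M_def)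
    moreover have "M * l < M * (- \<Lambda>)" using M l(2) by (intro mult_strict_left_mono)
    ultimately show False using k'(2) by (simp add: mult.commute)
  qed
qed

text \<open>For \<open>\<mu> \<le> 0\<close>, take \<open>t\<close> as the largest ratio
  \<open>\<phi> / \<psi>\<close> on a compact set \<open>K\<close> whose complement in the closure
  is covered by the boundary neighbourhoods. Then \<open>z = \<phi> - t * \<psi>\<close> is a strict
  subsolution that is nonpositive on \<open>K\<close> and can have no positive maximum near the
  boundary. So \<open>z \<le> 0\<close> everywhere, and its zero in \<open>K\<close> is an interior
  maximum, against strictness.\<close>

lemma eigenvalue_pos_if_strict_supersolution:
  fixes \<phi> \<psi> V :: "'a::euclidean_space \<Rightarrow> real"
  assumes dom: "smooth_bounded_domain \<Omega>" and \<Lambda>: "0 \<le> \<Lambda>"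
    and V: "\<And>x. x \<in> \<Omega> \<Longrightarrow> - V x \<le> \<Lambda>"
    and \<phi>: "positive_dirichlet \<Omega> \<phi>"
    and \<phi>l: "\<And>x. x \<in> \<Omega> \<Longrightarrow> - laplacian \<phi> x + V x * \<phi> x = \<mu> * \<phi> x"
    and \<psi>c: "continuous_on (closure \<Omega>) \<psi>"
    and \<psi>0: "\<And>x. x \<in> \<Omega> \<Longrightarrow> 0 < \<psi> x" and \<psi>f: "\<And>x. x \<in> frontier \<Omega> \<Longrightarrow> 0 \<le> \<psi> x"
    and \<psi>l: "\<And>x. x \<in> \<Omega> \<Longrightarrow> \<exists>d l. has_laplacian \<psi> x d l \<and> 0 < - l + V x * \<psi> x"
  shows "0 < \<mu>"
proof (rule ccontr)
  assume "\<not> 0 < \<mu>"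
  then have \<mu>: "\<mu> \<le> 0" by simp
  have op: "open \<Omega>" and ne: "\<Omega> \<noteq> {}" and bd: "bounded \<Omega>"
    using dom by (auto simp: smooth_bounded_domain_def)
  have \<phi>C: "Ck_on 2 \<phi> \<Omega>" and \<phi>c: "continuous_on (closure \<Omega>) \<phi>"
    and \<phi>0: "\<And>x. x \<in> \<Omega> \<Longrightarrow> 0 < \<phi> x" and \<phi>f: "\<And>x. x \<in> frontier \<Omega> \<Longrightarrow> \<phi> x = 0"
    using \<phi> by (auto simp: positive_dirichlet_def)
  \<comment> \<open>Stated with object-level quantifiers so that a neighbourhood \<open>W y\<close>
    can be chosen for all \<open>y\<close> simultaneously.\<close>
  have "\<forall>y\<in>frontier \<Omega>. \<exists>W. open W \<and> y \<in> W \<and>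
    (\<forall>z x. continuous_on (closure \<Omega>) z \<longrightarrow> (\<forall>x\<in>frontier \<Omega>. z x \<le> 0) \<longrightarrow>
       (\<forall>x\<in>\<Omega>. 0 < z x \<longrightarrow> (\<exists>d l. has_laplacian z x d l \<and> - l \<le> \<Lambda> * z x)) \<longrightarrow>
       x \<in> W \<inter> closure \<Omega> \<longrightarrow> (\<forall>x'\<in>closure \<Omega>. z x' \<le> z x) \<longrightarrow> z x \<le> 0)"
  proof
    fix y assume "y \<in> frontier \<Omega>"
    then obtain W where W: "open W" "y \<in> W"
      "\<And>z x. \<lbrakk>continuous_on (closure \<Omega>) z; \<And>x. x \<in> frontier \<Omega> \<Longrightarrow> z x \<le> 0;
       \<And>x. x \<in> \<Omega> \<Longrightarrow> 0 < z x \<Longrightarrow> \<exists>d l. has_laplacian z x d l \<and> - l \<le> \<Lambda> * z x;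
       x \<in> W \<inter> closure \<Omega>; \<And>x'. x' \<in> closure \<Omega> \<Longrightarrow> z x' \<le> z x\<rbrakk> \<Longrightarrow> z x \<le> 0"
      using no_max_near_boundary[OF dom _ \<Lambda>] by metis
    show "\<exists>W. open W \<and> y \<in> W \<and>
    (\<forall>z x. continuous_on (closure \<Omega>) z \<longrightarrow> (\<forall>x\<in>frontier \<Omega>. z x \<le> 0) \<longrightarrow>
       (\<forall>x\<in>\<Omega>. 0 < z x \<longrightarrow> (\<exists>d l. has_laplacian z x d l \<and> - l \<le> \<Lambda> * z x)) \<longrightarrow>
       x \<in> W \<inter> closure \<Omega> \<longrightarrow> (\<forall>x'\<in>closure \<Omega>. z x' \<le> z x) \<longrightarrow> z x \<le> 0)"
      using W by (intro exI[of _ W]) simp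
  qed
  then obtain W where Wo: "\<And>y. y \<in> frontier \<Omega> \<Longrightarrow> open (W y)" and Wy: "\<And>y. y \<in> frontier \<Omega> \<Longrightarrow> y \<in> W y"
    and Wz: "\<And>y z x. \<lbrakk>y \<in> frontier \<Omega>; continuous_on (closure \<Omega>) z; \<forall>x\<in>frontier \<Omega>. z x \<le> 0;
       \<forall>x\<in>\<Omega>. 0 < z x \<longrightarrow> (\<exists>d l. has_laplacian z x d l \<and> - l \<le> \<Lambda> * z x);
       x \<in> W y \<inter> closure \<Omega>; \<forall>x'\<in>closure \<Omega>. z x' \<le> z x\<rbrakk> \<Longrightarrow> z x \<le> 0"
    by metis
  obtain a where a: "a \<in> \<Omega>" using ne by blast
  \<comment> \<open>Removing the open sets \<open>W y\<close> removes the whole frontier and leaves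
    a compact subset of \<open>\<Omega>\<close>; the point \<open>a\<close> guarantees that
    \<open>K\<close> is nonempty.\<close>
  define K where "K = insert a (closure \<Omega> - (\<Union>y\<in>frontier \<Omega>. W y))"
  have Ksub: "K \<subseteq> \<Omega>"
    using a Wy op by (auto simp: K_def frontier_def interior_open)
  have "compact K"
    unfolding K_def using bd Wo by (intro compact_insert compact_diff) auto
  moreover have "continuous_on K (\<lambda>x. \<phi> x / \<psi> x)"
    using Ksub closure_subset[of \<Omega>] \<psi>0
    by (intro continuous_intros continuous_on_subset[OF \<phi>c] continuous_on_subset[OF \<psi>c]) force+
  ultimately obtain k where k: "k \<in> K" and kmax: "\<And>x. x \<in> K \<Longrightarrow> \<phi> x / \<psi> x \<le> \<phi> k / \<psi> k"
    using continuous_attains_sup[of K "\<lambda>x. \<phi> x / \<psi> x"] by (metis K_def insert_not_empty)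
  define t where "t = \<phi> k / \<psi> k"
  have k\<Omega>: "k \<in> \<Omega>" using k Ksub by auto
  have t: "t > 0" using \<phi>0[OF k\<Omega>] \<psi>0[OF k\<Omega>] by (simp add: t_def)
  define z where "z = (\<lambda>x. \<phi> x + (- t) * \<psi> x)"
  have zk: "z k = 0" using \<psi>0[OF k\<Omega>] by (simp add: z_def t_def)
  have zK: "z x \<le> 0" if "x \<in> K" for x
    using kmax[OF that] \<psi>0[of x] Ksub that by (auto simp: z_def t_def[symmetric] pos_divide_le_eq)
  \<comment> \<open>The operator applied to \<open>z\<close> gives \<open>\<mu> * \<phi> x\<close>,
    which is nonpositive, minus \<open>t\<close> times the strictly positive value for
    \<open>\<psi>\<close>.\<close>
  have zl: "\<exists>d l. has_laplacian z x d l \<and> - l + V x * z x < 0" if "x \<in> \<Omega>" for x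
  proof -
    obtain d l where l: "has_laplacian \<psi> x d l" "0 < - l + V x * \<psi> x" using \<psi>l[OF \<open>x \<in> \<Omega>\<close>] by blast
    have "has_laplacian z x (\<lambda>i. partial_deriv i \<phi> x + (- t) * d i) (laplacian \<phi> x + (- t) * l)"
      unfolding z_def by (intro has_laplacian_add has_laplacian_cmult l has_laplacian_Ck_on[OF \<phi>C op that])
    moreover have "- (laplacian \<phi> x + (- t) * l) + V x * z x = \<mu> * \<phi> x - t * (- l + V x * \<psi> x)"
      unfolding \<phi>l[OF that, symmetric] z_def by (simp add: algebra_simps)
    moreover have "\<mu> * \<phi> x \<le> 0" using \<mu> \<phi>0[OF that] by (simp add: mult_nonpos_nonneg)
    moreover have "t * (- l + V x * \<psi> x) > 0" using t l by simp
    ultimately show ?thesis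
      by (metis diff_gt_0_iff_gt diff_less_0_iff_less le_less_trans)
  qed
  have zc: "continuous_on (closure \<Omega>) z"
    unfolding z_def by (intro continuous_intros \<phi>c \<psi>c)
  have zf: "\<forall>x\<in>frontier \<Omega>. z x \<le> 0" using \<phi>f \<psi>f t by (simp add: z_def)
  obtain x0 where x0: "x0 \<in> closure \<Omega>" and zmax: "\<And>x. x \<in> closure \<Omega> \<Longrightarrow> z x \<le> z x0"
    using continuous_attains_sup[OF _ _ zc] bd ne by auto
  have "z x0 \<le> 0"
  proof (cases "x0 \<in> K")
    case True
    then show ?thesis by (rule zK)
  next
    case False
    then obtain y where y: "y \<in> frontier \<Omega>" "x0 \<in> W y" using x0 by (auto simp: K_def)
    \<comment> \<open>Where \<open>z\<close> is positive, the bound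
      \<open>- V x \<le> \<Lambda>\<close> replaces the potential by the constant for which the
      neighbourhoods were built.\<close>
    have "\<forall>x\<in>\<Omega>. 0 < z x \<longrightarrow> (\<exists>d l. has_laplacian z x d l \<and> - l \<le> \<Lambda> * z x)"
    proof (intro ballI impI)
      fix x assume x: "x \<in> \<Omega>" "0 < z x"
      obtain d l where "has_laplacian z x d l" "- l + V x * z x < 0" using zl[OF x(1)] by blast
      moreover have "(- V x) * z x \<le> \<Lambda> * z x" using V[OF x(1)] x(2) by (intro mult_right_mono) auto
      ultimately show "\<exists>d l. has_laplacian z x d l \<and> - l \<le> \<Lambda> * z x"
        by (intro exI[of _ d] exI[of _ l]) auto
    qed
    then show ?thesis using Wz[OF y(1) zc zf] y x0 zmax by blast
  qed
  then have "z x \<le> z k" if "x \<in> \<Omega>" for x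
    using zmax[of x] that closure_subset zk by fastforce
  moreover obtain d l where l: "has_laplacian z k d l" "- l + V k * z k < 0" using zl[OF k\<Omega>] by blast
  ultimately have "l \<le> 0" using has_laplacian_local_max[OF l(1) op k\<Omega>] by blast
  then show False using l(2) zk by simp
qed

text \<open>A maximum over the compact closure is positive, so it cannot lie on the frontier. This
  serves both to show \<open>lam1 \<ge> 0\<close> and to bound the solution when \<open>b\<close> is
  constant.\<close>

lemma positive_dirichlet_max:
  assumes dom: "smooth_bounded_domain \<Omega>" and u: "positive_dirichlet \<Omega> u"
  obtains x where "x \<in> \<Omega>" "\<And>y. y \<in> \<Omega> \<Longrightarrow> u y \<le> u x" "laplacian u x \<le> 0"
proof -
  have op: "open \<Omega>" and ne: "\<Omega> \<noteq> {}" and bd: "bounded \<Omega>"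
    using dom by (auto simp: smooth_bounded_domain_def)
  have uC: "Ck_on 2 u \<Omega>" and uc: "continuous_on (closure \<Omega>) u"
    and u0: "\<And>x. x \<in> \<Omega> \<Longrightarrow> 0 < u x" and uf: "\<And>x. x \<in> frontier \<Omega> \<Longrightarrow> u x = 0"
    using u by (auto simp: positive_dirichlet_def)
  obtain x where x: "x \<in> closure \<Omega>" and max: "\<And>y. y \<in> closure \<Omega> \<Longrightarrow> u y \<le> u x"
    using continuous_attains_sup[OF _ _ uc] bd ne by auto
  obtain a where "a \<in> \<Omega>" using ne by blast
  then have "0 < u x" using u0[of a] max[of a] closure_subset by fastforce
  then have x\<Omega>: "x \<in> \<Omega>" using uf[of x] x op by (auto simp: frontier_def interior_open)
  have max': "u y \<le> u x" if "y \<in> \<Omega>" for y using max[of y] that closure_subset by blast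
  show thesis
    using that[OF x\<Omega> max'] has_laplacian_local_max[OF has_laplacian_Ck_on[OF uC op x\<Omega>] op x\<Omega> max']
    by blast
qed

subsection \<open>The change of variable\<close>

context
  fixes \<kappa> :: real
  assumes \<kappa>: "0 < \<kappa>"
begin

lemma fk_zero: "fk \<kappa> 0 = 0"
  using fk_solves_cauchy[of \<kappa>] \<kappa> by (simp add: solves_cauchy_def)

lemma fk_deriv: "(fk \<kappa> has_real_derivative 1 / sqrt (1 + 2 * \<kappa> * (fk \<kappa> t)\<^sup>2)) (at t)"
  using fk_solves_cauchy[of \<kappa>] \<kappa> by (simp add: solves_cauchy_def)

lemma deriv_fk: "deriv (fk \<kappa>) = (\<lambda>t. 1 / sqrt (1 + 2 * \<kappa> * (fk \<kappa> t)\<^sup>2))"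
  using fk_deriv DERIV_imp_deriv by blast

lemma radicand_pos: "0 < 1 + 2 * \<kappa> * s\<^sup>2"
  using \<kappa> by (simp add: add_pos_nonneg)

lemma fk_strict_mono: "s < t \<Longrightarrow> fk \<kappa> s < fk \<kappa> t"
  by (erule DERIV_pos_imp_increasing, rule exI, rule conjI, rule fk_deriv) (simp add: radicand_pos)

lemma fk_pos: "0 < t \<Longrightarrow> 0 < fk \<kappa> t"
  using fk_strict_mono[of 0 t] fk_zero by simp

text \<open>With q the square root, the first derivative is 1/q and the derivative of q is
  \<open>2 * \<kappa> * fk \<kappa> t\<close> divided by the square of q. The result is negative
  where \<open>fk \<kappa> t\<close> is positive: this is the concavity used for the
  supersolution.\<close>

lemma fk_deriv2:
  "(deriv (fk \<kappa>) has_real_derivative - (2 * \<kappa> * fk \<kappa> t) / (sqrt (1 + 2 * \<kappa> * (fk \<kappa> t)\<^sup>2)) ^ 4) (at t)"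
proof -
  define q where "q = sqrt (1 + 2 * \<kappa> * (fk \<kappa> t)\<^sup>2)"
  have q: "q > 0" using radicand_pos by (simp add: q_def)
  have "((\<lambda>t. 1 + 2 * \<kappa> * (fk \<kappa> t)\<^sup>2) has_real_derivative 4 * \<kappa> * fk \<kappa> t * (1 / q)) (at t)"
    by (auto intro!: derivative_eq_intros fk_deriv simp: q_def)
  from DERIV_chain2[OF DERIV_real_sqrt[OF radicand_pos] this]
  have "((\<lambda>t. sqrt (1 + 2 * \<kappa> * (fk \<kappa> t)\<^sup>2)) has_real_derivative
      inverse q / 2 * (4 * \<kappa> * fk \<kappa> t * (1 / q))) (at t)"
    by (simp add: q_def)
  from DERIV_inverse'[OF this] q
  have "((\<lambda>t. inverse (sqrt (1 + 2 * \<kappa> * (fk \<kappa> t)\<^sup>2))) has_real_derivative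
      - (inverse q * (inverse q / 2 * (4 * \<kappa> * fk \<kappa> t * (1 / q))) * inverse q)) (at t)"
    by (simp add: q_def)
  moreover have "- (inverse q * (inverse q / 2 * (4 * \<kappa> * fk \<kappa> t * (1 / q))) * inverse q)
      = - (2 * \<kappa> * fk \<kappa> t) / q ^ 4"
    using q by (simp add: field_simps power4_eq_xxxx)
  ultimately show ?thesis
    unfolding deriv_fk q_def by (simp add: inverse_eq_divide)
qed

text \<open>The product rule leaves the numerator
  \<open>q\<^sup>2 - 2 * \<kappa> * (fk \<kappa> t)\<^sup>2\<close>, which is 1 by definition of
  \<open>q\<close>.\<close>

lemma deriv_fk_fk':
  "deriv (\<lambda>t. fk \<kappa> t * deriv (fk \<kappa>) t) t = 1 / (sqrt (1 + 2 * \<kappa> * (fk \<kappa> t)\<^sup>2)) ^ 4"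
proof -
  define q where "q = sqrt (1 + 2 * \<kappa> * (fk \<kappa> t)\<^sup>2)"
  have q: "q > 0" "q\<^sup>2 = 1 + 2 * \<kappa> * (fk \<kappa> t)\<^sup>2"
    using radicand_pos[of "fk \<kappa> t"] by (auto simp: q_def)
  have d: "deriv (fk \<kappa>) t = 1 / q" by (simp add: deriv_fk q_def)
  have "((\<lambda>t. fk \<kappa> t * deriv (fk \<kappa>) t) has_real_derivative
      (1 / q) * deriv (fk \<kappa>) t + (- (2 * \<kappa> * fk \<kappa> t) / q ^ 4) * fk \<kappa> t) (at t)"
    unfolding q_def by (rule DERIV_mult[OF fk_deriv fk_deriv2])
  moreover have "(1 / q) * deriv (fk \<kappa>) t + (- (2 * \<kappa> * fk \<kappa> t) / q ^ 4) * fk \<kappa> t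
      = (q\<^sup>2 - 2 * \<kappa> * (fk \<kappa> t)\<^sup>2) / q ^ 4"
    unfolding d using q(1) by (simp add: field_simps power4_eq_xxxx power2_eq_square)
  ultimately show ?thesis
    using q(2) by (metis DERIV_imp_deriv add_diff_cancel_right' q_def)
qed

text \<open>Product rule, with \<open>fk \<kappa> t powr (p - 1)\<close> factored out and
  \<open>2 * \<kappa> * (fk \<kappa> t)\<^sup>2\<close> rewritten as \<open>q\<^sup>2 - 1\<close>.
  Positivity of \<open>t\<close> keeps the base of \<open>powr\<close> positive.\<close>

lemma deriv_fk_powr_fk':
  assumes "0 < t"
  shows "deriv (\<lambda>t. fk \<kappa> t powr p * deriv (fk \<kappa>) t) t =
    fk \<kappa> t powr (p - 1) * ((p - 1) * (sqrt (1 + 2 * \<kappa> * (fk \<kappa> t)\<^sup>2))\<^sup>2 + 1)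
      / (sqrt (1 + 2 * \<kappa> * (fk \<kappa> t)\<^sup>2)) ^ 4"
proof -
  define q where "q = sqrt (1 + 2 * \<kappa> * (fk \<kappa> t)\<^sup>2)"
  have q: "q > 0" "2 * \<kappa> * (fk \<kappa> t)\<^sup>2 = q\<^sup>2 - 1"
    using radicand_pos[of "fk \<kappa> t"] by (auto simp: q_def)
  have f: "fk \<kappa> t > 0" using assms by (rule fk_pos)
  define E where "E = fk \<kappa> t powr (p - 1)"
  have Ef: "fk \<kappa> t powr p = E * fk \<kappa> t"
    using f by (simp add: E_def powr_diff)
  have d: "deriv (fk \<kappa>) t = 1 / q" by (simp add: deriv_fk q_def)
  have "((\<lambda>t. fk \<kappa> t powr p) has_real_derivative p * E * (1 / q)) (at t)"
    unfolding E_def q_def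
    by (rule DERIV_chain2[OF has_real_derivative_powr[OF f] fk_deriv])
  from DERIV_mult[OF this fk_deriv2]
  have "((\<lambda>t. fk \<kappa> t powr p * deriv (fk \<kappa>) t) has_real_derivative
      (p * E * (1 / q)) * deriv (fk \<kappa>) t + (- (2 * \<kappa> * fk \<kappa> t) / q ^ 4) * (E * fk \<kappa> t)) (at t)"
    unfolding q_def Ef .
  moreover have "(p * E * (1 / q)) * deriv (fk \<kappa>) t + (- (2 * \<kappa> * fk \<kappa> t) / q ^ 4) * (E * fk \<kappa> t)
      = E * (p * q\<^sup>2 - 2 * \<kappa> * (fk \<kappa> t)\<^sup>2) / q ^ 4"
    unfolding d using q(1) by (simp add: field_simps power4_eq_xxxx power2_eq_square)
  moreover have "p * q\<^sup>2 - 2 * \<kappa> * (fk \<kappa> t)\<^sup>2 = (p - 1) * q\<^sup>2 + 1"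
    unfolding q(2) by (simp add: algebra_simps)
  ultimately have "((\<lambda>t. fk \<kappa> t powr p * deriv (fk \<kappa>) t) has_real_derivative
      E * ((p - 1) * q\<^sup>2 + 1) / q ^ 4) (at t)"
    by (simp only:)
  from DERIV_imp_deriv[OF this] show ?thesis
    unfolding E_def q_def .
qed

end

section \<open>Linearized stability of the positive solution\<close>

theorem proposition4p1:
  fixes \<Omega> :: "'a::euclidean_space set"
    and b \<Theta> :: "'a \<Rightarrow> real"
    and p \<alpha> \<kappa> lam lam1 \<mu> :: real
  assumes "smooth_bounded_domain \<Omega>"
    and "1 < p"
    and "0 < \<alpha>" "\<alpha> < 1"
    and "hoelder_on \<alpha> (closure \<Omega>) b"
    and "\<forall>x\<in>closure \<Omega>. 0 \<le> b x"
    and "3 \<le> p \<or> (\<exists>\<beta>>0. \<forall>x\<in>closure \<Omega>. b x = \<beta>)"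
    and "is_principal_eigenvalue \<Omega> (\<lambda>\<phi> x. - laplacian \<phi> x) lam1"
    and "lam1 < lam"
    and "0 < \<kappa>"
    and "positive_solution \<Omega> \<kappa> p b lam \<Theta>"
    and "is_principal_eigenvalue \<Omega> (linearized_op \<kappa> p b lam \<Theta>) \<mu>"
  shows "0 < \<mu>"
proof -
  note dom = assms(1) and p = assms(2) and \<kappa> = assms(10)
  have op: "open \<Omega>" using dom by (simp add: smooth_bounded_domain_def)
  have b0: "0 \<le> b x" if "x \<in> \<Omega>" for x using assms(6) that closure_subset by blast
  obtain \<phi>1 where \<phi>1: "positive_dirichlet \<Omega> \<phi>1" "\<And>x. x \<in> \<Omega> \<Longrightarrow> - laplacian \<phi>1 x = lam1 * \<phi>1 x"
    using assms(8) unfolding is_principal_eigenvalue_def by blast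
  \<comment> \<open>At an interior maximum of the eigenfunction \<open>\<phi>1\<close> its negative
    Laplacian is nonnegative, hence so is \<open>lam1\<close>.\<close>
  have lam: "0 < lam"
  proof -
    obtain x where "x \<in> \<Omega>" "laplacian \<phi>1 x \<le> 0" using positive_dirichlet_max[OF dom \<phi>1(1)] by blast
    moreover from this have "0 < \<phi>1 x" using \<phi>1(1) by (simp add: positive_dirichlet_def)
    ultimately have "0 \<le> lam1" using \<phi>1(2)[of x] by (smt (verit) mult_neg_pos)
    then show ?thesis using assms(9) by simp
  qed
  have \<Theta>: "positive_dirichlet \<Omega> \<Theta>" using assms(11) by (simp add: positive_solution_def)
  have \<Theta>C: "Ck_on 2 \<Theta> \<Omega>" and \<Theta>c: "continuous_on (closure \<Omega>) \<Theta>"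
    and \<Theta>0: "\<And>x. x \<in> \<Omega> \<Longrightarrow> 0 < \<Theta> x" and \<Theta>f: "\<And>x. x \<in> frontier \<Omega> \<Longrightarrow> \<Theta> x = 0"
    using \<Theta> by (auto simp: positive_dirichlet_def)
  obtain \<phi> where \<phi>: "positive_dirichlet \<Omega> \<phi>"
    and \<phi>e: "\<And>x. x \<in> \<Omega> \<Longrightarrow> linearized_op \<kappa> p b lam \<Theta> \<phi> x = \<mu> * \<phi> x"
    using assms(12) unfolding is_principal_eigenvalue_def by blast
  define \<psi> where "\<psi> = (\<lambda>x. fk \<kappa> (\<Theta> x))"
  define q where "q = (\<lambda>x. sqrt (1 + 2 * \<kappa> * (\<psi> x)\<^sup>2))"
  define E where "E = (\<lambda>x. \<psi> x powr (p - 1))"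
  \<comment> \<open>The zeroth-order coefficient of the linearized operator at
    \<open>\<Theta>\<close>, with the two derivatives already evaluated in terms of \<open>q\<close>
    and \<open>E\<close>.\<close>
  define V where "V = (\<lambda>x. (b x * (E x * ((p - 1) * (q x)\<^sup>2 + 1)) - lam) / (q x) ^ 4)"
  have \<psi>0: "\<psi> x > 0" if "x \<in> \<Omega>" for x using \<Theta>0[OF that] fk_pos[OF \<kappa>] by (simp add: \<psi>_def)
  have E0: "E x > 0" if "x \<in> \<Omega>" for x using \<psi>0[OF that] by (simp add: E_def)
  have q1: "q x > 1" if "x \<in> \<Omega>" for x using \<psi>0[OF that] \<kappa> by (simp add: q_def)
  have q2: "(q x)\<^sup>2 > 1" if "x \<in> \<Omega>" for x using q1[OF that] by (simp add: one_less_power)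
  have \<Theta>e: "- laplacian \<Theta> x = \<psi> x / q x * (lam - b x * E x)" if "x \<in> \<Omega>" for x
  proof -
    have "\<psi> x powr p = E x * \<psi> x" using \<psi>0[OF that] by (simp add: E_def powr_diff)
    moreover have "- laplacian \<Theta> x = lam * (\<psi> x * (1 / q x)) - b x * (\<psi> x powr p * (1 / q x))"
      using assms(11) that by (simp add: positive_solution_def deriv_fk[OF \<kappa>] \<psi>_def q_def)
    ultimately show ?thesis by (simp add: algebra_simps diff_divide_distrib)
  qed
  \<comment> \<open>This is what remains of the linearized operator applied to \<open>\<psi>\<close>
    once the gradient term is dropped and \<open>\<psi> x / (q x) ^ 4\<close> is factored
    out.\<close>
  have pos: "0 < lam * ((q x)\<^sup>2 - 1) + b x * E x * ((p - 2) * (q x)\<^sup>2 + 1)" if x: "x \<in> \<Omega>" for x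
  proof (cases "3 \<le> p")
    case True
    then have "0 \<le> b x * E x * ((p - 2) * (q x)\<^sup>2 + 1)"
      using b0[OF x] E0[OF x] by (intro mult_nonneg_nonneg) auto
    moreover have "0 < lam * ((q x)\<^sup>2 - 1)" using lam q2[OF x] by simp
    ultimately show ?thesis by simp
  next
    case False
    then obtain \<beta> where \<beta>: "\<beta> > 0" "\<And>x. x \<in> \<Omega> \<Longrightarrow> b x = \<beta>"
      using assms(7) closure_subset by blast
    \<comment> \<open>At a maximum of \<open>\<Theta>\<close> the equation forces
      \<open>\<beta> * E x0 \<le> lam\<close>. Since \<open>fk \<kappa>\<close> and the power with
      exponent \<open>p - 1 > 0\<close> are increasing, the bound carries over to every
      \<open>x\<close>.\<close>
    obtain x0 where x0: "x0 \<in> \<Omega>" "\<And>y. y \<in> \<Omega> \<Longrightarrow> \<Theta> y \<le> \<Theta> x0" "laplacian \<Theta> x0 \<le> 0"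
      using positive_dirichlet_max[OF dom \<Theta>] by blast
    have "0 \<le> \<psi> x0 / q x0 * (lam - b x0 * E x0)" using \<Theta>e[OF x0(1)] x0(3) by simp
    moreover have "\<psi> x0 / q x0 > 0" using \<psi>0[OF x0(1)] q1[OF x0(1)] by simp
    ultimately have "0 \<le> lam - b x0 * E x0" by (meson leD mult_pos_neg not_le_imp_less)
    then have "\<beta> * E x0 \<le> lam" using \<beta>(2)[OF x0(1)] by simp
    moreover have "\<psi> x \<le> \<psi> x0"
      using x0(2)[OF x] fk_strict_mono[OF \<kappa>, of "\<Theta> x" "\<Theta> x0"] by (cases "\<Theta> x = \<Theta> x0") (auto simp: \<psi>_def)
    then have "E x \<le> E x0" using \<psi>0[OF x] p by (auto simp: E_def intro: powr_mono2)
    then have "\<beta> * E x \<le> \<beta> * E x0" using \<beta>(1) by simp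
    ultimately have "\<beta> * E x \<le> lam" by linarith
    \<comment> \<open>Replacing \<open>lam\<close> by the smaller \<open>\<beta> * E x\<close> turns
      the expression into \<open>\<beta> * E x * ((p - 1) * (q x)\<^sup>2)\<close>, which is
      positive for every \<open>p > 1\<close>.\<close>
    then have "\<beta> * E x * ((q x)\<^sup>2 - 1) \<le> lam * ((q x)\<^sup>2 - 1)"
      using q2[OF x] by (intro mult_right_mono) auto
    moreover have "0 < \<beta> * E x * ((p - 1) * (q x)\<^sup>2)"
      using \<beta>(1) E0[OF x] p q1[OF x] by simp
    ultimately show ?thesis using \<beta>(2)[OF x] by (simp add: algebra_simps)
  qed
  show ?thesis
  proof (rule eigenvalue_pos_if_strict_supersolution[OF dom, where \<Lambda> = lam and V = V and \<phi> = \<phi> and \<psi> = \<psi>])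
    show "0 \<le> lam" using lam by simp
    \<comment> \<open>The \<open>b\<close> term of \<open>V\<close> is nonnegative and
      \<open>q x > 1\<close>, so dividing by the fourth power only shrinks the part coming from
      \<open>lam\<close>.\<close>
    show "- V x \<le> lam" if x: "x \<in> \<Omega>" for x
    proof -
      have "(q x) ^ 4 \<ge> 1" using q1[OF x] by (simp add: one_le_power)
      moreover have "0 \<le> b x * (E x * ((p - 1) * (q x)\<^sup>2 + 1))"
        using b0[OF x] E0[OF x] p by (intro mult_nonneg_nonneg) auto
      moreover have "lam * 1 \<le> lam * (q x) ^ 4" using calculation(1) lam by (intro mult_left_mono) auto
      ultimately have "lam - b x * (E x * ((p - 1) * (q x)\<^sup>2 + 1)) \<le> lam * (q x) ^ 4" by linarith
      then have "(lam - b x * (E x * ((p - 1) * (q x)\<^sup>2 + 1))) / (q x) ^ 4 \<le> lam"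
        using q1[OF x] by (subst pos_divide_le_eq) auto
      then show ?thesis by (simp add: V_def minus_divide_left)
    qed
    show "positive_dirichlet \<Omega> \<phi>" by fact
    show "- laplacian \<phi> x + V x * \<phi> x = \<mu> * \<phi> x" if x: "x \<in> \<Omega>" for x
      unfolding \<phi>e[OF x, symmetric] linearized_op_def deriv_fk_fk'[OF \<kappa>] deriv_fk_powr_fk'[OF \<kappa> \<Theta>0[OF x]]
        V_def q_def E_def \<psi>_def
      by (simp add: algebra_simps diff_divide_distrib add_divide_distrib)
    show "continuous_on (closure \<Omega>) \<psi>"
      unfolding \<psi>_def
      by (rule continuous_on_compose2[OF _ \<Theta>c, of UNIV])
        (use DERIV_isCont[OF fk_deriv[OF \<kappa>]] in \<open>auto simp: continuous_at_imp_continuous_on\<close>)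
    show "0 < \<psi> x" if "x \<in> \<Omega>" for x using \<psi>0 that .
    show "0 \<le> \<psi> x" if "x \<in> frontier \<Omega>" for x using \<Theta>f[OF that] fk_zero[OF \<kappa>] by (simp add: \<psi>_def)
    show "\<exists>d l. has_laplacian \<psi> x d l \<and> 0 < - l + V x * \<psi> x" if x: "x \<in> \<Omega>" for x
    proof -
      define G where "G = (\<Sum>i\<in>Basis. (partial_deriv i \<Theta> x)\<^sup>2)"
      have "(fk \<kappa> has_real_derivative deriv (fk \<kappa>) t) (at t)" for t
        using fk_deriv[OF \<kappa>] by (simp add: deriv_fk[OF \<kappa>])
      from has_laplacian_compose[OF has_laplacian_Ck_on[OF \<Theta>C op x] this fk_deriv2[OF \<kappa>]]
      have "\<exists>d. has_laplacian \<psi> x d (1 / q x * laplacian \<Theta> x + - (2 * \<kappa> * \<psi> x) / (q x) ^ 4 * G)"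
        unfolding \<psi>_def q_def G_def deriv_fk[OF \<kappa>] by blast
      moreover have "0 < - (1 / q x * laplacian \<Theta> x + - (2 * \<kappa> * \<psi> x) / (q x) ^ 4 * G) + V x * \<psi> x"
      proof -
        have "G \<ge> 0" by (simp add: G_def sum_nonneg)
        then have "0 \<le> 2 * \<kappa> * \<psi> x / (q x) ^ 4 * G"
          using \<kappa> \<psi>0[OF x] q1[OF x] by simp
        \<comment> \<open>The equation for \<open>\<Theta>\<close> contributes
          \<open>(q x)\<^sup>2 * (lam - b x * E x)\<close> to the bracket; adding the numerator of
          \<open>V\<close> lowers \<open>p - 1\<close> to \<open>p - 2\<close>.\<close>
        moreover have "1 / q x * (- laplacian \<Theta> x) + V x * \<psi> x =
            \<psi> x / (q x) ^ 4 * (lam * ((q x)\<^sup>2 - 1) + b x * E x * ((p - 2) * (q x)\<^sup>2 + 1))"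
          unfolding \<Theta>e[OF x] V_def using q1[OF x]
          by (simp add: field_simps power4_eq_xxxx power2_eq_square)
        moreover have "0 < \<psi> x / (q x) ^ 4 * (lam * ((q x)\<^sup>2 - 1) + b x * E x * ((p - 2) * (q x)\<^sup>2 + 1))"
          using pos[OF x] \<psi>0[OF x] q1[OF x] by simp
        ultimately show ?thesis by simp
      qed
      ultimately show ?thesis by blast
    qed
  qed
qed

end
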